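(* Let $n$ be a positive integer and fix any positive integer $\kappa$. The following are equivalent: (a) There are infinitely many primes $p$ such that, with $\omega:=e^{\frac{2\pi i}{p-1}}$, $\dim E_n(\omega,p,\kappa)=1$. (b) $\displaystyle \frac{1}{p-1}\sum_{d\mid p-1}\mu\left(\frac{p-1}{d}\right)\gcd(n^d-1,p)=1$ for infinitely many primes $p$. (c) The Artin conjecture is true for $n$, i.e., $n$ is a primitive root modulo $p$ for infinitely many primes $p$.
   Context: $\mathcal{R}$ is the complex vector space of rational functions over $\mathbb{C}$ analytic at the origin, identified with their Taylor series; $U_n\left(\sum_{k\ge 0}a(k)x^k\right)=\sum_{k\ge 0}a(nk)x^k$. For positive integers $L,\kappa$, $$\mathcal{R}(L,\kappa)=\left\{f\in\mathcal{R}\mid f(x)=\sum_{k\ge0}k^{\kappa-1}a(k)x^k,\ a(k+L)=a(k)\text{ for all }k\ge 0\right\}$$ (with $0^0=1$), and $E_n(\omega,L,\kappa)=\{f\in\mathcal{R}(L,\kappa)\mid U_n f=n^{\kappa-1}\omega f\}$. $\mu$ is the M\"obius function and $\gcd(0,p)=p$. *)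

theory Defs
  imports
    "HOL-Analysis.Analysis"
    "HOL-Computational_Algebra.Computational_Algebra"
    "HOL-Number_Theory.Number_Theory"
begin

text \<open>
  Rational functions over the complex numbers that are analytic at the origin are represented by
  their Taylor series there.  Division by a power series with nonzero constant term is
  multiplication by its inverse.
\<close>

definition ratfun_fps :: "complex fps set" where
  "ratfun_fps = {f. \<exists>p q. poly q 0 \<noteq> 0 \<and> f = fps_of_poly p / fps_of_poly q}"

interpretation fps_vs: vector_space "\<lambda>(c::complex) f. fps_const c * f"
proof
  fix a b :: complex and f g :: "complex fps"
  show "fps_const a * (f + g) = fps_const a * f + fps_const a * g"
    by (rule distrib_left)
  show "fps_const (a + b) * f = fps_const a * f + fps_const b * f"
    by (simp add: distrib_right flip: fps_const_add)
  show "fps_const a * (fps_const b * f) = fps_const (a * b) * f"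
    by (simp add: mult.assoc flip: fps_const_mult)
  show "fps_const 1 * f = f"
    by simp
qed

definition U :: "nat \<Rightarrow> complex fps \<Rightarrow> complex fps" where
  "U n f = Abs_fps (\<lambda>k. fps_nth f (n * k))"

definition R_space :: "nat \<Rightarrow> nat \<Rightarrow> complex fps set" where
  "R_space L \<kappa> = {f \<in> ratfun_fps. \<exists>a :: nat \<Rightarrow> complex.
     f = Abs_fps (\<lambda>k. of_nat k ^ (\<kappa> - 1) * a k) \<and> (\<forall>k. a (k + L) = a k)}"

definition E_space :: "nat \<Rightarrow> complex \<Rightarrow> nat \<Rightarrow> nat \<Rightarrow> complex fps set" where
  "E_space n \<omega> L \<kappa> =
     {f \<in> R_space L \<kappa>. U n f = fps_const (of_nat n ^ (\<kappa> - 1) * \<omega>) * f}"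

text \<open>
  For an arbitrary set, \<open>fps_vs.dim\<close> is the dimension of its span (and 0 if that is infinite);
  it is therefore relevant that these sets are subspaces.
\<close>

lemma subspace_ratfun_fps: "fps_vs.subspace ratfun_fps"
proof (rule fps_vs.subspaceI)
  show "0 \<in> ratfun_fps"
    unfolding ratfun_fps_def by (rule CollectI, rule exI[of _ 0], rule exI[of _ 1]) simp
next
  fix f g assume "f \<in> ratfun_fps" "g \<in> ratfun_fps"
  then obtain p q r s where *: "poly q 0 \<noteq> 0" "poly s 0 \<noteq> 0"
    "f = fps_of_poly p / fps_of_poly q" "g = fps_of_poly r / fps_of_poly s"
    unfolding ratfun_fps_def by blast
  have u: "fps_nth (fps_of_poly q) 0 \<noteq> 0" "fps_nth (fps_of_poly s) 0 \<noteq> 0"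
    using * by (simp_all add: poly_0_coeff_0)
  have i: "inverse (fps_of_poly q) * fps_of_poly q = 1"
    "inverse (fps_of_poly s) * fps_of_poly s = 1"
    using u by (simp_all add: inverse_mult_eq_1)
  have "f + g = fps_of_poly (p * s + r * q) / fps_of_poly (q * s)"
  proof -
    have "fps_of_poly (p * s + r * q) / fps_of_poly (q * s) =
      (fps_of_poly p * fps_of_poly s + fps_of_poly r * fps_of_poly q) *
      (inverse (fps_of_poly q) * inverse (fps_of_poly s))"
      using u by (simp add: fps_divide_unit fps_of_poly_mult fps_of_poly_add fps_inverse_mult)
    also have "\<dots> = fps_of_poly p * inverse (fps_of_poly q) * (inverse (fps_of_poly s) * fps_of_poly s)
      + fps_of_poly r * inverse (fps_of_poly s) * (inverse (fps_of_poly q) * fps_of_poly q)"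
      by (simp add: algebra_simps)
    finally show ?thesis using u i * by (simp add: fps_divide_unit)
  qed
  moreover have "poly (q * s) 0 \<noteq> 0" using * by simp
  ultimately show "f + g \<in> ratfun_fps" unfolding ratfun_fps_def by blast
next
  fix c f assume "f \<in> ratfun_fps"
  then obtain p q where *: "poly q 0 \<noteq> 0" "f = fps_of_poly p / fps_of_poly q"
    unfolding ratfun_fps_def by blast
  have u: "fps_nth (fps_of_poly q) 0 \<noteq> 0" using * by (simp add: poly_0_coeff_0)
  have "fps_const c * f = fps_of_poly (Polynomial.smult c p) / fps_of_poly q"
    using u * by (simp add: fps_divide_unit fps_of_poly_smult mult.assoc)
  with * show "fps_const c * f \<in> ratfun_fps" unfolding ratfun_fps_def by blast
qed

lemma subspace_E_space: "fps_vs.subspace (E_space n \<omega> L \<kappa>)"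
proof (rule fps_vs.subspaceI)
  show "0 \<in> E_space n \<omega> L \<kappa>"
    using fps_vs.subspace_0[OF subspace_ratfun_fps]
    by (auto simp: E_space_def R_space_def U_def fps_eq_iff intro!: exI[of _ "\<lambda>_. 0"])
next
  fix f g assume "f \<in> E_space n \<omega> L \<kappa>" "g \<in> E_space n \<omega> L \<kappa>"
  then obtain a b where
    fg: "f \<in> ratfun_fps" "g \<in> ratfun_fps"
      "f = Abs_fps (\<lambda>k. of_nat k ^ (\<kappa> - 1) * a k)" "\<forall>k. a (k + L) = a k"
      "g = Abs_fps (\<lambda>k. of_nat k ^ (\<kappa> - 1) * b k)" "\<forall>k. b (k + L) = b k"
      "U n f = fps_const (of_nat n ^ (\<kappa> - 1) * \<omega>) * f"
      "U n g = fps_const (of_nat n ^ (\<kappa> - 1) * \<omega>) * g"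
    unfolding E_space_def R_space_def by blast
  have 1: "f + g \<in> ratfun_fps"
    using fps_vs.subspace_add[OF subspace_ratfun_fps fg(1,2)] .
  have 2: "f + g = Abs_fps (\<lambda>k. of_nat k ^ (\<kappa> - 1) * (a k + b k))"
    unfolding fg(3,5) by (simp add: fps_eq_iff distrib_left)
  have 3: "\<forall>k. a (k + L) + b (k + L) = a k + b k"
    using fg(4,6) by simp
  have "U n (f + g) = U n f + U n g"
    by (simp add: U_def fps_eq_iff)
  also have "\<dots> = fps_const (of_nat n ^ (\<kappa> - 1) * \<omega>) * (f + g)"
    unfolding fg(7,8) by (rule distrib_left [symmetric])
  finally show "f + g \<in> E_space n \<omega> L \<kappa>"
    unfolding E_space_def R_space_def mem_Collect_eq
    by (intro conjI exI[of _ "\<lambda>k. a k + b k"] 1 2 3)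
next
  fix c f assume "f \<in> E_space n \<omega> L \<kappa>"
  then obtain a where
    f: "f \<in> ratfun_fps"
      "f = Abs_fps (\<lambda>k. of_nat k ^ (\<kappa> - 1) * a k)" "\<forall>k. a (k + L) = a k"
      "U n f = fps_const (of_nat n ^ (\<kappa> - 1) * \<omega>) * f"
    unfolding E_space_def R_space_def by blast
  have 1: "fps_const c * f \<in> ratfun_fps"
    using fps_vs.subspace_scale[OF subspace_ratfun_fps f(1)] .
  have 2: "fps_const c * f = Abs_fps (\<lambda>k. of_nat k ^ (\<kappa> - 1) * (c * a k))"
    unfolding f(2) by (simp add: fps_eq_iff)
  have 3: "\<forall>k. c * a (k + L) = c * a k"
    using f(3) by simp
  have "U n (fps_const c * f) = fps_const c * U n f"
    by (simp add: U_def fps_eq_iff)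
  also have "\<dots> = fps_const (of_nat n ^ (\<kappa> - 1) * \<omega>) * (fps_const c * f)"
    unfolding f(4) by (rule mult.left_commute)
  finally show "fps_const c * f \<in> E_space n \<omega> L \<kappa>"
    unfolding E_space_def R_space_def mem_Collect_eq
    by (intro conjI exI[of _ "\<lambda>k. c * a k"] 1 2 3)
qed

definition moebius_mu :: "nat \<Rightarrow> int" where
  "moebius_mu n = (if squarefree n then (-1) ^ card (prime_factors n) else 0)"

end

theory Submission
  imports Defs
begin

text \<open>
  For a prime \<open>p > 2\<close> not dividing \<open>n\<close>, that is, for all but finitely many primes, both the dimension
  of the eigenspace and the average of gcds are the indicator of \<open>n\<close> being a primitive root modulo \<open>p\<close>; see
  \<open>dim_E_space_eq_1_iff\<close> and \<open>moebius_gcd_average\<close>. Infinitude ignores finitely many exceptions.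

  Dimension: cancelling the weights \<open>k ^ (\<kappa> - 1)\<close>, an eigenvector is a function \<open>a\<close> of period \<open>p\<close>
  with \<open>a (n * k) = \<omega> * a k\<close>. Going around a cycle of multiplication by \<open>n\<close> on the nonzero residues,
  whose length is the order of \<open>n\<close>, gives \<open>a = \<omega> ^ ord p n * a\<close>. As \<open>\<omega>\<close> has exact order \<open>p - 1\<close>, this
  forces \<open>a = 0\<close> there unless \<open>n\<close> is a primitive root; also \<open>a 0 = 0\<close> because \<open>\<omega> \<noteq> 1\<close>. For a primitive
  root there is a single cycle, and the eigenspace is spanned by the series of \<open>n ^ i \<mapsto> \<omega> ^ i\<close>.
  This series is a rational function, being obtained from a polynomial over \<open>1 - x ^ p\<close> by
  repeated application of \<open>x d/dx\<close>.

  Average: \<open>gcd (n ^ d - 1) p\<close> is \<open>1 + (p - 1) * [ord p n dvd d]\<close>. The divisor sum of the Moebius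
  function kills the constant part and leaves \<open>p - 1\<close> times the sum over the multiples \<open>d\<close> of the
  order, which is 1 if the order is \<open>p - 1\<close> and 0 otherwise.
\<close>

section \<open>Rationality of periodic series\<close>

lemma ratfun_fps_iff:
  "f \<in> ratfun_fps \<longleftrightarrow> (\<exists>p q. poly q 0 \<noteq> 0 \<and> f * fps_of_poly q = fps_of_poly p)"
proof -
  have "f = fps_of_poly p / fps_of_poly q \<longleftrightarrow> f * fps_of_poly q = fps_of_poly p"
    if "poly q 0 \<noteq> 0" for p q :: "complex poly"
  proof -
    have u: "fps_nth (fps_of_poly q) 0 \<noteq> 0"
      using that by (simp add: poly_0_coeff_0)
    show ?thesis
      using inverse_mult_eq_1[OF u] inverse_mult_eq_1'[OF u]
      unfolding fps_divide_unit[OF u] by (metis mult.assoc mult.right_neutral)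
  qed
  then show ?thesis
    unfolding ratfun_fps_def by blast
qed

text \<open>
  From \<open>f * q = p\<close> the product rule gives \<open>f' * q\<^sup>2 = p' * q - p * q'\<close>, and \<open>q\<^sup>2\<close> is again nonzero at 0.
\<close>

lemma fps_XD_ratfun:
  assumes "f \<in> ratfun_fps"
  shows "fps_XD f \<in> ratfun_fps"
proof -
  obtain p q where q: "poly q 0 \<noteq> 0" and fq: "f * fps_of_poly q = fps_of_poly p"
    using assms by (auto simp: ratfun_fps_iff)
  have "fps_deriv (f * fps_of_poly q) = fps_deriv (fps_of_poly p)"
    by (simp only: fq)
  then have "fps_deriv f * fps_of_poly q =
      fps_of_poly (pderiv p) - f * fps_of_poly (pderiv q)"
    by (simp add: fps_of_poly_pderiv algebra_simps)
  then have "fps_XD f * fps_of_poly (q * q) =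
      fps_X * ((fps_of_poly (pderiv p) - f * fps_of_poly (pderiv q)) * fps_of_poly q)"
    by (simp add: fps_XD_def fps_of_poly_mult mult_ac)
  also have "\<dots> = fps_X * (fps_of_poly (pderiv p) * fps_of_poly q -
      f * fps_of_poly q * fps_of_poly (pderiv q))"
    by (simp add: algebra_simps)
  also have "\<dots> = fps_of_poly (Polynomial.monom 1 1 * (pderiv p * q - p * pderiv q))"
    by (simp add: fq fps_of_poly_mult fps_of_poly_diff fps_of_poly_monom')
  finally show ?thesis
    using q unfolding ratfun_fps_iff by (metis mult_eq_0_iff poly_mult)
qed

text \<open>Multiplication by \<open>1 - x ^ L\<close> cuts a series of period \<open>L\<close> down to its first period.\<close>

lemma periodic_series_ratfun:
  fixes a :: "nat \<Rightarrow> complex"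
  assumes "L > 0" and "\<forall>k. a (k + L) = a k"
  shows "Abs_fps a \<in> ratfun_fps"
proof -
  let ?q = "1 - Polynomial.monom 1 L :: complex poly"
  have "Abs_fps a * fps_of_poly ?q = fps_of_poly (Poly (map a [0..<L]))"
  proof (rule fps_ext)
    fix k
    have "fps_nth (Abs_fps a * fps_of_poly ?q) k = a k - (if k < L then 0 else a (k - L))"
      by (simp add: fps_of_poly_diff fps_of_poly_monom' right_diff_distrib
          fps_X_power_mult_right_nth)
    also have "\<dots> = (if k < L then a k else 0)"
      using assms(2)[rule_format, of "k - L"] by (cases "k < L") simp_all
    also have "\<dots> = fps_nth (fps_of_poly (Poly (map a [0..<L]))) k"
      by (simp add: nth_default_def)
    finally show "fps_nth (Abs_fps a * fps_of_poly ?q) k =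
      fps_nth (fps_of_poly (Poly (map a [0..<L]))) k" .
  qed
  moreover have "poly ?q 0 \<noteq> 0"
    using assms(1) by (simp add: poly_monom power_0_left)
  ultimately show ?thesis
    unfolding ratfun_fps_iff by blast
qed

lemma weighted_periodic_series_ratfun:
  fixes a :: "nat \<Rightarrow> complex"
  assumes "L > 0" and "\<forall>k. a (k + L) = a k"
  shows "Abs_fps (\<lambda>k. of_nat k ^ m * a k) \<in> ratfun_fps"
proof (induction m)
  case 0
  then show ?case
    using periodic_series_ratfun[OF assms] by simp
next
  case (Suc m)
  have "Abs_fps (\<lambda>k. of_nat k ^ Suc m * a k) = fps_XD (Abs_fps (\<lambda>k. of_nat k ^ m * a k))"
    by (simp add: fps_eq_iff)
  with fps_XD_ratfun[OF Suc] show ?case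
    by simp
qed

section \<open>The eigenspaces as spaces of periodic functions\<close>

lemma periodic_cong:
  fixes a :: "nat \<Rightarrow> 'b"
  assumes per: "\<forall>k. a (k + L) = a k" and "[i = j] (mod L)"
  shows "a i = a j"
proof -
  have "a (k + L * m) = a k" for k m
    by (induction m) (simp_all add: per add.assoc[symmetric] add.commute[of L])
  from this[of "i mod L" "i div L"] this[of "j mod L" "j div L"] show ?thesis
    using assms(2) by (simp add: cong_def)
qed

text \<open>
  The eigenvalue \<open>n ^ (\<kappa> - 1) * \<omega>\<close> is scaled so that the weights cancel: what remains does not depend
  on \<open>\<kappa>\<close>, and rationality is automatic.
\<close>

lemma E_space_eq_eigenfunctions:
  assumes "n > 0" and "L > 0"
  shows "E_space n \<omega> L \<kappa> = {Abs_fps (\<lambda>k. of_nat k ^ (\<kappa> - 1) * a k) | a.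
    (\<forall>k. a (k + L) = a k) \<and> (\<forall>k. a (n * k) = \<omega> * a k)}" (is "_ = ?R")
proof (intro equalityI subsetI)
  fix f assume "f \<in> E_space n \<omega> L \<kappa>"
  then obtain a where f: "f = Abs_fps (\<lambda>k. of_nat k ^ (\<kappa> - 1) * a k)"
    and per: "\<forall>k. a (k + L) = a k"
    and eig: "U n f = fps_const (of_nat n ^ (\<kappa> - 1) * \<omega>) * f"
    unfolding E_space_def R_space_def by blast
  have pos: "a (n * k) = \<omega> * a k" if "k > 0" for k
  proof -
    have "of_nat (n * k) ^ (\<kappa> - 1) * a (n * k)
        = of_nat n ^ (\<kappa> - 1) * \<omega> * (of_nat k ^ (\<kappa> - 1) * a k)"
      using arg_cong[OF eig, of "\<lambda>g. fps_nth g k"] by (simp add: U_def f)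
    then have "of_nat (n * k) ^ (\<kappa> - 1) * a (n * k) = of_nat (n * k) ^ (\<kappa> - 1) * (\<omega> * a k)"
      by (simp add: power_mult_distrib)
    moreover have "(of_nat (n * k) :: complex) ^ (\<kappa> - 1) \<noteq> 0"
      using assms that by simp
    ultimately show ?thesis
      by (simp only: mult_cancel_left) simp
  qed
  have "a (n * k) = \<omega> * a k" for k
  proof -
    \<comment> \<open>The coefficient at \<open>0\<close> may be killed by the weight; periodicity recovers \<open>a 0\<close> from \<open>a L\<close>.\<close>
    have "a (n * (k + L)) = a (n * k)"
      by (rule periodic_cong[OF per]) (simp add: cong_def algebra_simps)
    then show ?thesis
      using pos[of "k + L"] assms per by simp
  qed
  then show "f \<in> ?R"
    using f per by blast
next
  fix f assume "f \<in> ?R"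
  then obtain a where f: "f = Abs_fps (\<lambda>k. of_nat k ^ (\<kappa> - 1) * a k)"
    and per: "\<forall>k. a (k + L) = a k" and eig: "\<forall>k. a (n * k) = \<omega> * a k"
    by blast
  have "U n f = fps_const (of_nat n ^ (\<kappa> - 1) * \<omega>) * f"
    by (simp add: U_def f fps_eq_iff eig power_mult_distrib)
  then show "f \<in> E_space n \<omega> L \<kappa>"
    using weighted_periodic_series_ratfun[OF assms(2) per] f per
    unfolding E_space_def R_space_def by blast
qed

lemma eigenfunction_power:
  fixes a :: "nat \<Rightarrow> complex"
  assumes "\<forall>k. a (n * k) = \<omega> * a k"
  shows "a (n ^ i * k) = \<omega> ^ i * a k"
  by (induction i) (simp_all add: assms mult.assoc)

text \<open>
  Multiplying \<open>ord L n\<close> times by \<open>n\<close> returns every residue to itself, but multiplies an eigenfunction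
  by \<open>\<omega> ^ ord L n\<close>, so it must vanish. If \<open>n\<close> is not coprime to \<open>L\<close>, then \<open>ord L n = 0\<close> and the last
  assumption fails.
\<close>

lemma dim_E_space_eq_0:
  assumes "n > 0" and "L > 0" and "\<omega> ^ ord L n \<noteq> 1"
  shows "fps_vs.dim (E_space n \<omega> L \<kappa>) = 0"
proof -
  have "f = 0" if f_in: "f \<in> E_space n \<omega> L \<kappa>" for f
  proof -
    obtain a where f: "f = Abs_fps (\<lambda>k. of_nat k ^ (\<kappa> - 1) * a k)"
      and per: "\<forall>k. a (k + L) = a k" and eig: "\<forall>k. a (n * k) = \<omega> * a k"
      using f_in unfolding E_space_eq_eigenfunctions[OF assms(1,2)] by blast
    have "a k = 0" for k
    proof -
      have "[n ^ ord L n * k = 1 * k] (mod L)"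
        by (intro cong_mult ord cong_refl)
      then have "a (n ^ ord L n * k) = a k"
        using periodic_cong[OF per] by simp
      then have "\<omega> ^ ord L n * a k = a k"
        by (simp add: eigenfunction_power[OF eig])
      with assms(3) show ?thesis
        by simp
    qed
    then show ?thesis
      by (simp add: f fps_eq_iff)
  qed
  then have "E_space n \<omega> L \<kappa> \<subseteq> fps_vs.span {}"
    by auto
  then have "fps_vs.dim (E_space n \<omega> L \<kappa>) \<le> card ({} :: complex fps set)"
    by (rule fps_vs.dim_le_card) simp
  then show ?thesis
    by simp
qed

text \<open>
  For a primitive root \<open>n\<close> the nonzero residues form a single cycle under multiplication by \<open>n\<close>, so
  an eigenfunction is determined by its value at \<open>1\<close>; and \<open>n ^ i \<mapsto> \<omega> ^ i\<close> is well defined because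
  exponents only matter modulo \<open>p - 1\<close>.
\<close>

lemma dim_E_space_primroot:
  assumes "prime p" and prim: "residue_primroot p n" and "n > 0"
    and root: "\<omega> ^ (p - 1) = 1" and "\<omega> \<noteq> 1"
  shows "fps_vs.dim (E_space n \<omega> p \<kappa>) = 1"
proof -
  have p: "p > 1"
    using \<open>prime p\<close> by (rule prime_gt_1_nat)
  have cop: "coprime p n" and ordn: "ord p n = p - 1"
    using assms by (simp_all add: residue_primroot_def totient_prime)
  have gen: "\<exists>i. [n ^ i = k] (mod p)" if "\<not> p dvd k" for k
  proof -
    have "k mod p > 0"
      using that by (simp add: dvd_eq_mod_eq_0)
    moreover have "coprime (k mod p) p"
      using prime_imp_coprime[OF \<open>prime p\<close> that] p by (simp add: coprime_commute)
    ultimately have "k mod p \<in> totatives p"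
      using p by (simp add: in_totatives_iff less_imp_le)
    then have "k mod p \<in> (\<lambda>i. n ^ i mod p) ` {..<totient p}"
      using residue_primroot_is_generator[OF p prim] by (simp add: bij_betw_def)
    then show ?thesis
      by (auto simp: cong_def)
  qed
  have exps: "\<omega> ^ i = \<omega> ^ j" if "[n ^ i = n ^ j] (mod p)" for i j
  proof -
    have "[i = j] (mod (p - 1))"
      using that order_divides_expdiff[OF cop] ordn by simp
    then have ij: "i mod (p - 1) = j mod (p - 1)"
      by (simp add: cong_def)
    have red: "\<omega> ^ k = \<omega> ^ (k mod (p - 1))" for k
    proof -
      have "\<omega> ^ k = \<omega> ^ ((p - 1) * (k div (p - 1)) + k mod (p - 1))"
        by simp
      also have "\<dots> = \<omega> ^ (k mod (p - 1))"
        by (simp only: power_add power_mult root) simp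
      finally show ?thesis .
    qed
    show ?thesis
      by (simp only: red[of i] red[of j] ij)
  qed
  define a where "a = (\<lambda>k. if p dvd k then 0 else \<omega> ^ (SOME i. [n ^ i = k] (mod p)))"
  have a_eq: "a k = \<omega> ^ i" if "[n ^ i = k] (mod p)" for k i
  proof -
    have "\<not> p dvd k"
    proof
      assume "p dvd k"
      then have "p dvd n ^ i"
        using cong_dvd_iff[OF that] by simp
      then have "p dvd n"
        using \<open>prime p\<close> prime_dvd_power by blast
      with cop p show False
        using coprime_absorb_left[of p n] by simp
    qed
    moreover have "[n ^ (SOME i. [n ^ i = k] (mod p)) = k] (mod p)"
      using that by (rule someI)
    then have "\<omega> ^ (SOME i. [n ^ i = k] (mod p)) = \<omega> ^ i"
      using exps cong_trans[OF _ cong_sym[OF that]] by blast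
    ultimately show ?thesis
      by (simp add: a_def)
  qed
  have per: "\<forall>k. a (k + p) = a k"
    by (simp add: a_def cong_def)
  have eig: "\<forall>k. a (n * k) = \<omega> * a k"
  proof
    fix k
    show "a (n * k) = \<omega> * a k"
    proof (cases "p dvd k")
      case True
      then show ?thesis
        by (simp add: a_def)
    next
      case False
      then obtain i where i: "[n ^ i = k] (mod p)"
        using gen by blast
      then have "[n ^ Suc i = n * k] (mod p)"
        by (simp add: cong_scalar_left)
      from a_eq[OF this] a_eq[OF i] show ?thesis
        by simp
    qed
  qed
  have a1: "a 1 = 1"
    using a_eq[of 0 1] by simp
  define e where "e = Abs_fps (\<lambda>k. of_nat k ^ (\<kappa> - 1) * a k)"
  have "e \<in> E_space n \<omega> p \<kappa>"
    using per eig p unfolding E_space_eq_eigenfunctions[OF \<open>n > 0\<close> order.strict_trans[OF zero_less_one p]] e_def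
    by blast
  moreover have "E_space n \<omega> p \<kappa> \<subseteq> fps_vs.span {e}"
  proof
    fix f assume "f \<in> E_space n \<omega> p \<kappa>"
    then obtain b where f: "f = Abs_fps (\<lambda>k. of_nat k ^ (\<kappa> - 1) * b k)"
      and bper: "\<forall>k. b (k + p) = b k" and beig: "\<forall>k. b (n * k) = \<omega> * b k"
      using E_space_eq_eigenfunctions[OF \<open>n > 0\<close> order.strict_trans[OF zero_less_one p]] by blast
    have bk: "b k = b 1 * a k" for k
    proof (cases "p dvd k")
      case True
      then have "b k = b 0"
        by (intro periodic_cong[OF bper]) (simp add: cong_def)
      moreover have "b 0 = 0"
        using spec[OF beig, of 0] \<open>\<omega> \<noteq> 1\<close> by simp
      ultimately show ?thesis
        using True by (simp add: a_def)
    next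
      case False
      then obtain i where i: "[n ^ i = k] (mod p)"
        using gen by blast
      then have "b k = b (n ^ i * 1)"
        using periodic_cong[OF bper cong_sym[OF i]] by simp
      then show ?thesis
        using eigenfunction_power[OF beig, of i 1] a_eq[OF i] by simp
    qed
    have "f = fps_const (b 1) * e"
    proof (rule fps_ext)
      show "fps_nth f k = fps_nth (fps_const (b 1) * e) k" for k
        using bk[of k] by (simp add: f e_def)
    qed
    then show "f \<in> fps_vs.span {e}"
      by (simp add: fps_vs.span_base fps_vs.span_scale)
  qed
  moreover have "e \<noteq> 0"
  proof -
    have "fps_nth e 1 = 1"
      using a1 by (simp add: e_def)
    then show ?thesis
      by auto
  qed
  ultimately show ?thesis
    by (intro fps_vs.dim_unique[of "{e}"]) auto
qed

lemma dim_E_space_eq_1_iff: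
  assumes "prime p" and "p > 2" and "\<not> p dvd n"
  shows "fps_vs.dim (E_space n (exp (2 * of_real pi * \<i> / of_nat (p - 1))) p \<kappa>) = 1
    \<longleftrightarrow> residue_primroot p n"
proof -
  define \<omega> :: complex where "\<omega> = exp (2 * of_real pi * \<i> / of_nat (p - 1))"
  have n: "n > 0"
    using assms(3) by (cases n) auto
  have pow: "\<omega> ^ j = 1 \<longleftrightarrow> p - 1 dvd j" for j
  proof -
    have "\<omega> ^ j = exp (2 * of_real pi * \<i> * of_nat j / of_nat (p - 1))"
      by (simp add: \<omega>_def exp_of_nat_mult[symmetric] mult_ac)
    then show ?thesis
      using complex_root_unity_eq_1[of "p - 1" j] assms(2) by simp
  qed
  have cop: "coprime p n"
    using assms by (simp add: prime_imp_coprime)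
  have prim_iff: "residue_primroot p n \<longleftrightarrow> ord p n = p - 1"
    using cop assms by (simp add: residue_primroot_def totient_prime)
  have "ord p n dvd p - 1"
    using order_divides_totient[of p n] cop assms(1) by (simp add: totient_prime)
  then have ord_iff: "p - 1 dvd ord p n \<longleftrightarrow> ord p n = p - 1"
    by (auto intro: dvd_antisym)
  show ?thesis
  proof (cases "residue_primroot p n")
    case True
    have "\<omega> \<noteq> 1"
      using pow[of 1] assms(2) by simp
    with True show ?thesis
      using dim_E_space_primroot[OF assms(1) True n, of \<omega>] pow[of "p - 1"] by (simp add: \<omega>_def)
  next
    case False
    then have "\<omega> ^ ord p n \<noteq> 1"
      using prim_iff ord_iff pow by simp
    with False show ?thesis
      using dim_E_space_eq_0[of n p \<omega>] n assms(2) by (simp add: \<omega>_def)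
  qed
qed

section \<open>The Moebius sum\<close>

text \<open>
  Only squarefree divisors contribute; they correspond to the sets of prime divisors of \<open>m\<close>, and
  the signed count of the subsets of a nonempty set \<open>A\<close> is the expansion of \<open>\<Prod>x\<in>A. (1 - 1)\<close>.
\<close>

lemma sum_moebius_mu_divisors:
  assumes "m > 0"
  shows "(\<Sum>d | d dvd m. moebius_mu d) = (if m = 1 then 1 else 0)"
proof -
  have fin: "finite {d. d dvd m}"
    using assms by simp
  have primes: "prime q" if "X \<subseteq> prime_factors m" "q \<in> X" for X q
    using that by auto
  have pf: "prime_factors (\<Prod>X) = X" if "X \<subseteq> prime_factors m" for X
  proof -
    have "finite X"
      using that finite_subset by blast
    moreover have "0 \<notin> X"
      using primes[OF that] not_prime_0 by blast
    ultimately have "prime_factors (\<Prod>X) = (\<Union>q\<in>X. prime_factors q)"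
      using prime_factors_prod[of X "\<lambda>q. q"] by simp
    also have "\<dots> = X"
      using primes[OF that] by (auto simp: prime_prime_factors)
    finally show ?thesis .
  qed
  have sqf: "squarefree (\<Prod>X)" if "X \<subseteq> prime_factors m" for X
    using primes[OF that]
    by (intro squarefree_prod_coprime squarefree_prime) (auto intro: primes_coprime)
  have prod_pf: "\<Prod>(prime_factors d) = d" if "squarefree d" for d :: nat
  proof -
    have "d \<noteq> 0"
      using that not_squarefree_0 by metis
    then have "d = (\<Prod>q\<in>prime_factors d. q ^ multiplicity q d)"
      using prod_prime_factors[of d] by simp
    also have "\<dots> = \<Prod>(prime_factors d)"
      using that \<open>d \<noteq> 0\<close> by (intro prod.cong) (auto simp: squarefree_factorial_semiring')
    finally show ?thesis by simp
  qed
  have dvd: "\<Prod>X dvd m" if "X \<subseteq> prime_factors m" for X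
  proof -
    have "\<Prod>X dvd \<Prod>(prime_factors m)"
      using that by (intro prod_dvd_prod_subset) auto
    also have "\<dots> dvd (\<Prod>q\<in>prime_factors m. q ^ multiplicity q m)"
      by (intro prod_dvd_prod) (auto simp: prime_factors_multiplicity)
    also have "\<dots> = m"
      using assms prod_prime_factors[of m] by simp
    finally show ?thesis .
  qed
  have mono: "prime_factors d \<subseteq> prime_factors m" if "d dvd m" for d
    using dvd_prime_factors[OF _ that] assms by simp
  have "(\<Sum>d | d dvd m. moebius_mu d) = (\<Sum>d | d dvd m \<and> squarefree d. (-1) ^ card (prime_factors d))"
    using fin by (intro sum.mono_neutral_cong_right) (auto simp: moebius_mu_def)
  also have "\<dots> = (\<Sum>X\<in>Pow (prime_factors m). (-1) ^ card X)"
    using assms pf sqf prod_pf dvd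
    by (intro sum.reindex_bij_witness[of _ "\<lambda>X. \<Prod>X" prime_factors])
      (auto dest: mono[THEN subsetD])
  also have "\<dots> = (\<Prod>q\<in>prime_factors m. 1 - 1)"
    by (subst prod_diff_conv_sum) simp_all
  also have "\<dots> = (if m = 1 then 1 else 0)"
  proof (cases "m = 1")
    case False
    then obtain q where "prime q" "q dvd m"
      using prime_factor_nat by blast
    then have "prime_factors m \<noteq> {}"
      using assms by (auto simp: prime_factors_dvd)
    then have "card (prime_factors m) > 0"
      by (simp only: card_gt_0_iff) simp
    with False show ?thesis
      by simp
  qed simp
  finally show ?thesis .
qed

lemma sum_moebius_mu_codivisors:
  assumes "m > 0"
  shows "(\<Sum>d | d dvd m. moebius_mu (m div d)) = (if m = 1 then 1 else 0)"
proof -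
  have "(\<Sum>d | d dvd m. moebius_mu (m div d)) = (\<Sum>d | d dvd m. moebius_mu d)"
    using assms by (intro sum.reindex_bij_witness[of _ "\<lambda>d. m div d" "\<lambda>d. m div d"]) auto
  then show ?thesis
    by (simp only: sum_moebius_mu_divisors[OF assms])
qed

text \<open>Writing \<open>d = r * e\<close> turns this into the full divisor sum for \<open>m div r\<close>.\<close>

lemma sum_moebius_mu_multiples:
  assumes "m > 0" and "r dvd m"
  shows "(\<Sum>d | d dvd m \<and> r dvd d. moebius_mu (m div d)) = (if r = m then 1 else 0)"
proof -
  obtain t where m: "m = r * t"
    using assms(2) by (rule dvdE)
  have pos: "r > 0" "t > 0"
    using assms(1) m by auto
  have "(\<Sum>d | d dvd m \<and> r dvd d. moebius_mu (m div d)) = (\<Sum>d | d dvd t. moebius_mu (t div d))"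
    using pos
    by (intro sum.reindex_bij_witness[of _ "\<lambda>d. r * d" "\<lambda>d. d div r"]) (auto simp: m elim!: dvdE)
  also have "\<dots> = (if t = 1 then 1 else 0)"
    using sum_moebius_mu_codivisors[OF pos(2)] .
  also have "\<dots> = (if r = m then 1 else 0)"
    using pos m by auto
  finally show ?thesis .
qed

lemma gcd_power_minus_1_prime:
  assumes "prime p"
  shows "gcd (int n ^ d - 1) (int p) = (if ord p n dvd d then int p else 1)"
proof -
  have "int p dvd int n ^ d - 1 \<longleftrightarrow> [int n ^ d = 1] (mod int p)"
    by (simp add: cong_iff_dvd_diff)
  also have "\<dots> \<longleftrightarrow> ord p n dvd d"
    using cong_int_iff[of "n ^ d" 1 p] by (simp add: ord_divides')
  finally have *: "int p dvd int n ^ d - 1 \<longleftrightarrow> ord p n dvd d" .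
  show ?thesis
  proof (cases "ord p n dvd d")
    case True
    with * show ?thesis
      by (simp add: gcd_proj2_iff)
  next
    case False
    with * have "coprime (int p) (int n ^ d - 1)"
      using assms by (intro prime_imp_coprime) auto
    with False show ?thesis
      by (simp add: gcd.commute)
  qed
qed

lemma moebius_gcd_average:
  assumes "prime p" and "p > 2" and "\<not> p dvd n"
  shows "1 / real (p - 1) * (\<Sum>d | d dvd p - 1.
      of_int (moebius_mu ((p - 1) div d) * gcd (int n ^ d - 1) (int p)))
    = (if residue_primroot p n then 1 else 0)"
proof -
  let ?m = "p - 1" and ?r = "ord p n"
  have cop: "coprime p n"
    using assms by (simp add: prime_imp_coprime)
  have r: "?r dvd ?m"
    using order_divides_totient[of p n] cop assms(1) by (simp add: totient_prime)
  have fin: "finite {d. d dvd ?m}"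
    using assms(2) by simp
  \<comment> \<open>Split the gcd as \<open>1\<close> plus \<open>p - 1\<close> times the indicator of \<open>ord p n dvd d\<close>.\<close>
  have "(\<Sum>d | d dvd ?m. moebius_mu (?m div d) * gcd (int n ^ d - 1) (int p))
      = (\<Sum>d | d dvd ?m. moebius_mu (?m div d)
          + int ?m * (if ?r dvd d then moebius_mu (?m div d) else 0))"
    using assms(2)
    by (intro sum.cong) (auto simp: gcd_power_minus_1_prime[OF assms(1)] of_nat_diff algebra_simps)
  also have "\<dots> = (\<Sum>d | d dvd ?m. moebius_mu (?m div d))
      + int ?m * (\<Sum>d | d dvd ?m \<and> ?r dvd d. moebius_mu (?m div d))"
    using fin by (simp add: sum.distrib sum_distrib_left[symmetric] sum.inter_filter[symmetric])
  also have "\<dots> = int ?m * (if ?r = ?m then 1 else 0)"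
    using sum_moebius_mu_codivisors[of ?m] sum_moebius_mu_multiples[OF _ r] assms(2) by simp
  finally have "(\<Sum>d | d dvd ?m. moebius_mu (?m div d) * gcd (int n ^ d - 1) (int p))
      = int ?m * (if ?r = ?m then 1 else 0)" .
  moreover have "residue_primroot p n \<longleftrightarrow> ?r = ?m"
    using cop assms by (simp add: residue_primroot_def totient_prime)
  ultimately show ?thesis
    using assms(2) by (simp only: of_int_sum[symmetric]) simp
qed

section \<open>Equivalence of the three conditions\<close>

lemma infinite_primes_cong:
  assumes "\<And>p :: nat. prime p \<Longrightarrow> p > N \<Longrightarrow> P p \<longleftrightarrow> Q p"
  shows "infinite {p. prime p \<and> P p} \<longleftrightarrow> infinite {p. prime p \<and> Q p}"
proof -
  have "{p. prime p \<and> P p} - {..N} = {p. prime p \<and> Q p} - {..N}"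
    using assms by auto
  then show ?thesis
    by (metis finite_Diff2 finite_atMost)
qed

theorem theorem15:
  fixes n \<kappa> :: nat
  assumes "n > 0" and "\<kappa> > 0"
  shows "(infinite {p :: nat. prime p \<and>
            fps_vs.dim (E_space n (exp (2 * of_real pi * \<i> / of_nat (p - 1))) p \<kappa>) = 1}
          \<longleftrightarrow>
          infinite {p :: nat. prime p \<and>
            1 / real (p - 1) * (\<Sum>d | d dvd p - 1.
              of_int (moebius_mu ((p - 1) div d) * gcd (int n ^ d - 1) (int p))) = 1})
       \<and> (infinite {p :: nat. prime p \<and>
            1 / real (p - 1) * (\<Sum>d | d dvd p - 1.
              of_int (moebius_mu ((p - 1) div d) * gcd (int n ^ d - 1) (int p))) = 1}
          \<longleftrightarrow>
          infinite {p :: nat. prime p \<and> residue_primroot p n})"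
proof -
  have large: "p > 2" "\<not> p dvd n" if "p > max 2 n" for p
    using that assms(1) by (auto dest: dvd_imp_le)
  have dim: "fps_vs.dim (E_space n (exp (2 * of_real pi * \<i> / of_nat (p - 1))) p \<kappa>) = 1
      \<longleftrightarrow> residue_primroot p n" if "prime p" "p > max 2 n" for p
    using dim_E_space_eq_1_iff large that by blast
  have avg: "1 / real (p - 1) * (\<Sum>d | d dvd p - 1.
        of_int (moebius_mu ((p - 1) div d) * gcd (int n ^ d - 1) (int p))) = 1
      \<longleftrightarrow> residue_primroot p n" if "prime p" "p > max 2 n" for p
    unfolding moebius_gcd_average[OF that(1) large[OF that(2)]] by simp
  show ?thesis
    by (intro conjI infinite_primes_cong[of "max 2 n"]) (simp_all only: dim avg)
qed

end
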